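(* For every integer $\gamma\ge0$, the vector space $\mathcal{F}_\gamma$ of $\gamma$-edge valued binary trees, endowed with the operations $\hookleftarrow_a,\hookrightarrow_a$ ($a\in[\gamma]$) defined below, is the free $\gamma$-multiplicial algebra over one generator, the generator being the tree with one internal node: $\mathcal{F}_\gamma$ is a $\gamma$-multiplicial algebra, and for every $\gamma$-multiplicial algebra $A$ and every $e\in A$ there is a unique linear map $\mathcal{F}_\gamma\to A$ commuting with all the operations and sending the one-node tree to $e$.
   Context: $\mathbb{K}$ is a field of characteristic zero, $[n]=\{1,\dots,n\}$, $a\downarrow a'=\min(a,a')$, with $a\downarrow\infty=a=\infty\downarrow a$. A $\gamma$-multiplicial algebra is a vector space with bilinear operations $\hookleftarrow_a,\hookrightarrow_a$, $a\in[\gamma]$, such that for all $x,y,z$ and $a,a'\in[\gamma]$: $(x\hookrightarrow_{a'}y)\hookleftarrow_a z=x\hookrightarrow_{a'}(y\hookleftarrow_a z)$; $(x\hookleftarrow_{a'}y)\hookleftarrow_a z=x\hookleftarrow_{a\downarrow a'}(y\hookleftarrow_a z)$; $(x\hookrightarrow_a y)\hookrightarrow_{a\downarrow a'}z=x\hookrightarrow_a(y\hookrightarrow_{a'}z)$. A $\gamma$-edge valued binary tree is a planar binary tree with at least one internal node in which every edge joining two internal nodes is labeled by an element of $[\gamma]$; edges from an internal node to a leaf are regarded as labeled $\infty$. $\mathcal{F}_\gamma$ has basis these trees. Write $\ell$ for the leaf and $N(x,t_1;y,t_2)$ for the tree whose root has left subtree $t_1$ via an edge labeled $x$ and right subtree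 $t_2$ via an edge labeled $y$. Operations (bilinear, recursive): for a tree $s$, $s\hookleftarrow_a\ell:=s$, $\ell\hookrightarrow_a s:=s$, $\ell\hookleftarrow_a s:=0$, $s\hookrightarrow_a\ell:=0$; for $t=N(x,t_1;y,t_2)$, $t\hookleftarrow_a s:=N(x,t_1;a\downarrow y,t_2\hookleftarrow_a s)$ and $s\hookrightarrow_a t:=N(a\downarrow x,s\hookrightarrow_a t_1;y,t_2)$.
   Formalization: The rules ℓ↩_a s := 0 and s↪_a ℓ := 0 are replaced by ℓ↩_a s := s and s↪_a ℓ := s (grafting s at the leaf); with the value 0 all products vanish and F_γ is not free for γ ≥ 1 (take A = K with multiplication, e = 1). *)

theory Defs
  imports Complex_Main "HOL-Library.Poly_Mapping" "HOL-Library.Extended_Nat" "HOL-Library.FuncSet"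
begin

(* A multiplicial algebra lives on a linear subspace V of an ambient vector space, so that
   spaces depending on the natural number gamma can be carriers; V may be UNIV. *)
locale multiplicial_algebra = vector_space scale
  for scale :: "'k::field_char_0 \<Rightarrow> 'b::ab_group_add \<Rightarrow> 'b" (infixr \<open>*s\<close> 75) +
  fixes \<gamma> :: nat
    and V :: "'b set"
    and L :: "nat \<Rightarrow> 'b \<Rightarrow> 'b \<Rightarrow> 'b"
    and R :: "nat \<Rightarrow> 'b \<Rightarrow> 'b \<Rightarrow> 'b"
  assumes subspace_carrier: "subspace V"
    and L_closed: "\<lbrakk>a \<in> {1..\<gamma>}; x \<in> V; y \<in> V\<rbrakk> \<Longrightarrow> L a x y \<in> V"
    and R_closed: "\<lbrakk>a \<in> {1..\<gamma>}; x \<in> V; y \<in> V\<rbrakk> \<Longrightarrow> R a x y \<in> V"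
    and L_add_left: "\<lbrakk>a \<in> {1..\<gamma>}; x \<in> V; y \<in> V; z \<in> V\<rbrakk> \<Longrightarrow> L a (x + y) z = L a x z + L a y z"
    and L_add_right: "\<lbrakk>a \<in> {1..\<gamma>}; x \<in> V; y \<in> V; z \<in> V\<rbrakk> \<Longrightarrow> L a x (y + z) = L a x y + L a x z"
    and L_scale_left: "\<lbrakk>a \<in> {1..\<gamma>}; x \<in> V; y \<in> V\<rbrakk> \<Longrightarrow> L a (c *s x) y = c *s L a x y"
    and L_scale_right: "\<lbrakk>a \<in> {1..\<gamma>}; x \<in> V; y \<in> V\<rbrakk> \<Longrightarrow> L a x (c *s y) = c *s L a x y"
    and R_add_left: "\<lbrakk>a \<in> {1..\<gamma>}; x \<in> V; y \<in> V; z \<in> V\<rbrakk> \<Longrightarrow> R a (x + y) z = R a x z + R a y z"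
    and R_add_right: "\<lbrakk>a \<in> {1..\<gamma>}; x \<in> V; y \<in> V; z \<in> V\<rbrakk> \<Longrightarrow> R a x (y + z) = R a x y + R a x z"
    and R_scale_left: "\<lbrakk>a \<in> {1..\<gamma>}; x \<in> V; y \<in> V\<rbrakk> \<Longrightarrow> R a (c *s x) y = c *s R a x y"
    and R_scale_right: "\<lbrakk>a \<in> {1..\<gamma>}; x \<in> V; y \<in> V\<rbrakk> \<Longrightarrow> R a x (c *s y) = c *s R a x y"
    and R_L: "\<lbrakk>a \<in> {1..\<gamma>}; a' \<in> {1..\<gamma>}; x \<in> V; y \<in> V; z \<in> V\<rbrakk>
      \<Longrightarrow> L a (R a' x y) z = R a' x (L a y z)"
    and L_L: "\<lbrakk>a \<in> {1..\<gamma>}; a' \<in> {1..\<gamma>}; x \<in> V; y \<in> V; z \<in> V\<rbrakk>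
      \<Longrightarrow> L a (L a' x y) z = L (min a a') x (L a y z)"
    and R_R: "\<lbrakk>a \<in> {1..\<gamma>}; a' \<in> {1..\<gamma>}; x \<in> V; y \<in> V; z \<in> V\<rbrakk>
      \<Longrightarrow> R (min a a') (R a x y) z = R a x (R a' y z)"

definition linear_map_on ::
  "('k::field_char_0 \<Rightarrow> 'b::ab_group_add \<Rightarrow> 'b) \<Rightarrow> ('k \<Rightarrow> 'c::ab_group_add \<Rightarrow> 'c)
    \<Rightarrow> 'b set \<Rightarrow> ('b \<Rightarrow> 'c) \<Rightarrow> bool"
  where "linear_map_on s\<^sub>1 s\<^sub>2 V f \<longleftrightarrow>
    (\<forall>x\<in>V. \<forall>y\<in>V. f (x + y) = f x + f y) \<and> (\<forall>c. \<forall>x\<in>V. f (s\<^sub>1 c x) = s\<^sub>2 c (f x))"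

definition commutes_on ::
  "nat \<Rightarrow> (nat \<Rightarrow> 'b \<Rightarrow> 'b \<Rightarrow> 'b) \<Rightarrow> (nat \<Rightarrow> 'c \<Rightarrow> 'c \<Rightarrow> 'c) \<Rightarrow> 'b set \<Rightarrow> ('b \<Rightarrow> 'c) \<Rightarrow> bool"
  where "commutes_on \<gamma> P Q V f \<longleftrightarrow>
    (\<forall>a\<in>{1..\<gamma>}. \<forall>x\<in>V. \<forall>y\<in>V. f (P a x y) = Q a (f x) (f y))"

(* Node x t1 y t2 stands for N(x,t1;y,t2). *)
datatype evtree = Leaf | Node enat evtree enat evtree

fun edge_ok :: "nat \<Rightarrow> enat \<Rightarrow> evtree \<Rightarrow> bool" where
  "edge_ok \<gamma> x Leaf \<longleftrightarrow> x = \<infinity>"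
| "edge_ok \<gamma> x (Node _ _ _ _) \<longleftrightarrow> x \<in> enat ` {1..\<gamma>}"

fun labels_ok :: "nat \<Rightarrow> evtree \<Rightarrow> bool" where
  "labels_ok \<gamma> Leaf \<longleftrightarrow> True"
| "labels_ok \<gamma> (Node x t\<^sub>1 y t\<^sub>2) \<longleftrightarrow>
    edge_ok \<gamma> x t\<^sub>1 \<and> edge_ok \<gamma> y t\<^sub>2 \<and> labels_ok \<gamma> t\<^sub>1 \<and> labels_ok \<gamma> t\<^sub>2"

definition evtrees :: "nat \<Rightarrow> evtree set" where
  "evtrees \<gamma> = {t. t \<noteq> Leaf \<and> labels_ok \<gamma> t}"

(* The leaf is neutral on both sides. With the value 0 for Leaf on the left of tree_L (or on the
   right of tree_R) every product would vanish, since the recursion always descends to a leaf,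
   and the resulting algebra would not be free. *)
fun tree_L :: "nat \<Rightarrow> evtree \<Rightarrow> evtree \<Rightarrow> evtree" where
  "tree_L a t Leaf = t"
| "tree_L a Leaf s = s"
| "tree_L a (Node x t\<^sub>1 y t\<^sub>2) s = Node x t\<^sub>1 (min (enat a) y) (tree_L a t\<^sub>2 s)"

fun tree_R :: "nat \<Rightarrow> evtree \<Rightarrow> evtree \<Rightarrow> evtree" where
  "tree_R a Leaf t = t"
| "tree_R a s Leaf = s"
| "tree_R a s (Node x t\<^sub>1 y t\<^sub>2) = Node (min (enat a) x) (tree_R a s t\<^sub>1) y t\<^sub>2"

definition F_space :: "nat \<Rightarrow> (evtree \<Rightarrow>\<^sub>0 'k::field_char_0) set" where
  "F_space \<gamma> = {v. Poly_Mapping.keys v \<subseteq> evtrees \<gamma>}"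

definition F_scale :: "'k::field_char_0 \<Rightarrow> (evtree \<Rightarrow>\<^sub>0 'k) \<Rightarrow> (evtree \<Rightarrow>\<^sub>0 'k)" where
  "F_scale c v = Poly_Mapping.map ((*) c) v"

definition bilinear_ext ::
  "(evtree \<Rightarrow> evtree \<Rightarrow> evtree) \<Rightarrow> (evtree \<Rightarrow>\<^sub>0 'k::field_char_0) \<Rightarrow> (evtree \<Rightarrow>\<^sub>0 'k) \<Rightarrow> (evtree \<Rightarrow>\<^sub>0 'k)"
  where "bilinear_ext p u v =
    (\<Sum>s\<in>Poly_Mapping.keys u. \<Sum>t\<in>Poly_Mapping.keys v.
      Poly_Mapping.single (p s t) (Poly_Mapping.lookup u s * Poly_Mapping.lookup v t))"

definition F_L :: "nat \<Rightarrow> (evtree \<Rightarrow>\<^sub>0 'k::field_char_0) \<Rightarrow> (evtree \<Rightarrow>\<^sub>0 'k) \<Rightarrow> (evtree \<Rightarrow>\<^sub>0 'k)" where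
  "F_L a = bilinear_ext (tree_L a)"

definition F_R :: "nat \<Rightarrow> (evtree \<Rightarrow>\<^sub>0 'k::field_char_0) \<Rightarrow> (evtree \<Rightarrow>\<^sub>0 'k) \<Rightarrow> (evtree \<Rightarrow>\<^sub>0 'k)" where
  "F_R a = bilinear_ext (tree_R a)"

definition F_gen :: "evtree \<Rightarrow>\<^sub>0 'k::field_char_0" where
  "F_gen = Poly_Mapping.single (Node \<infinity> Leaf \<infinity> Leaf) 1"

end

(* The tree N(x,t1;y,t2) is the product t1 R_x (o L_y t2) of its subtrees with the one-node tree o
   (a factor is dropped when the subtree is a leaf). Hence o generates all trees, and a morphism is
   determined by the image e of o. Conversely, this formula defines the image of every tree in A,
   and it is compatible with L_a because two of the axioms say exactly how L_a passes through it:
   (t1 R_x (e L_y t2)) L_a s = t1 R_x (e L_(min a y) (t2 L_a s)).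
   Reflecting trees and reversing products exchanges the two families of operations, which turns
   this into the compatibility with R_a. *)
theory Submission
  imports Defs
begin

section \<open>Linear extension\<close>

lemma linear_map_on_eq_on_span:
  assumes "vector_space s\<^sub>1"
    and f: "linear_map_on s\<^sub>1 s\<^sub>2 (module.span s\<^sub>1 B) f"
    and g: "linear_map_on s\<^sub>1 s\<^sub>2 (module.span s\<^sub>1 B) g"
    and eq: "\<And>x. x \<in> B \<Longrightarrow> f x = g x"
    and v: "v \<in> module.span s\<^sub>1 B"
  shows "f v = g v"
proof -
  interpret vector_space s\<^sub>1 by fact
  have zero: "h 0 = 0" if "linear_map_on s\<^sub>1 s\<^sub>2 (span B) h" for h
  proof -
    have "h (0 + 0) = h 0 + h 0"
      using that span_zero unfolding linear_map_on_def by blast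
    then show ?thesis by simp
  qed
  from v have "v \<in> span B \<and> f v = g v"
  proof (induction rule: span_induct_alt)
    case base
    then show ?case by (simp add: zero f g span_zero)
  next
    case (step c x y)
    then have "s\<^sub>1 c x \<in> span B" "x \<in> span B" "y \<in> span B"
      by (simp_all add: span_base span_scale)
    then show ?case
      using step eq f g by (simp add: linear_map_on_def span_add)
  qed
  then show ?thesis ..
qed

definition lin_ext :: "('k::field \<Rightarrow> 'b::ab_group_add \<Rightarrow> 'b) \<Rightarrow> ('a \<Rightarrow> 'b) \<Rightarrow> ('a \<Rightarrow>\<^sub>0 'k) \<Rightarrow> 'b"
  where "lin_ext s \<phi> v = (\<Sum>t\<in>Poly_Mapping.keys v. s (Poly_Mapping.lookup v t) (\<phi> t))"

context vector_space
begin

lemma lin_ext_superset: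
  assumes "finite S" "Poly_Mapping.keys v \<subseteq> S"
  shows "lin_ext scale \<phi> v = (\<Sum>t\<in>S. scale (Poly_Mapping.lookup v t) (\<phi> t))"
  unfolding lin_ext_def using assms
  by (intro sum.mono_neutral_left) (auto simp: in_keys_iff)

lemma lin_ext_add: "lin_ext scale \<phi> (u + v) = lin_ext scale \<phi> u + lin_ext scale \<phi> v"
proof -
  let ?S = "Poly_Mapping.keys u \<union> Poly_Mapping.keys v"
  have "Poly_Mapping.keys (u + v) \<subseteq> ?S"
    by (rule Poly_Mapping.keys_add)
  then show ?thesis
    by (simp add: lin_ext_superset[where S = ?S] lookup_add scale_left_distrib sum.distrib)
qed

lemma lin_ext_single: "lin_ext scale \<phi> (Poly_Mapping.single t c) = scale c (\<phi> t)"
  by (simp add: lin_ext_superset[where S = "{t}"])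

lemma lin_ext_in_subspace:
  assumes "subspace V" "\<phi> ` Poly_Mapping.keys v \<subseteq> V"
  shows "lin_ext scale \<phi> v \<in> V"
  unfolding lin_ext_def using assms by (intro subspace_sum subspace_scale) auto

end

lemma lookup_F_scale: "Poly_Mapping.lookup (F_scale c v) t = c * Poly_Mapping.lookup v t"
  by (simp add: F_scale_def map.rep_eq when_def)

lemma keys_F_scale_subset: "Poly_Mapping.keys (F_scale c v) \<subseteq> Poly_Mapping.keys v"
  by (auto simp: in_keys_iff lookup_F_scale)

lemma F_scale_single: "F_scale c (Poly_Mapping.single t d) = Poly_Mapping.single t (c * d)"
  by (rule poly_mapping_eqI) (simp add: lookup_F_scale lookup_single when_def)

interpretation F: vector_space F_scale
  by unfold_locales (rule poly_mapping_eqI, simp add: lookup_F_scale lookup_add algebra_simps)+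

lemma lin_ext_F_scale:
  assumes "vector_space scale"
  shows "lin_ext scale \<phi> (F_scale c v) = scale c (lin_ext scale \<phi> v)"
proof -
  interpret vector_space scale by fact
  show ?thesis
    by (simp add: lin_ext_superset[where S = "Poly_Mapping.keys v"] keys_F_scale_subset
        lookup_F_scale scale_sum_right)
qed

lemma linear_map_on_lin_ext:
  assumes "vector_space scale"
  shows "linear_map_on F_scale scale U (lin_ext scale \<phi>)"
  using assms by (simp add: linear_map_on_def vector_space.lin_ext_add lin_ext_F_scale)

lemma lin_ext_F_scale_single_1: "lin_ext F_scale (\<lambda>t. Poly_Mapping.single t 1) v = v"
proof (rule poly_mapping_eqI)
  fix t
  show "Poly_Mapping.lookup (lin_ext F_scale (\<lambda>t. Poly_Mapping.single t 1) v) t =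
      Poly_Mapping.lookup v t"
    by (simp add: lin_ext_def lookup_sum F_scale_single lookup_single when_def in_keys_iff)
qed

lemma bilinear_ext_eq_left:
  "bilinear_ext p u v =
    lin_ext F_scale (\<lambda>s. lin_ext F_scale (\<lambda>t. Poly_Mapping.single (p s t) 1) v) u"
  by (simp add: bilinear_ext_def lin_ext_def F.scale_sum_right F_scale_single)

lemma bilinear_ext_eq_right:
  "bilinear_ext p u v =
    lin_ext F_scale (\<lambda>t. lin_ext F_scale (\<lambda>s. Poly_Mapping.single (p s t) 1) u) v"
  unfolding bilinear_ext_def
  by (subst sum.swap) (simp add: lin_ext_def F.scale_sum_right F_scale_single mult.commute)

lemma bilinear_ext_add_left: "bilinear_ext p (u + v) w = bilinear_ext p u w + bilinear_ext p v w"
  by (simp add: bilinear_ext_eq_left F.lin_ext_add)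

lemma bilinear_ext_add_right: "bilinear_ext p u (v + w) = bilinear_ext p u v + bilinear_ext p u w"
  by (simp add: bilinear_ext_eq_right F.lin_ext_add)

lemma bilinear_ext_scale_left: "bilinear_ext p (F_scale c u) v = F_scale c (bilinear_ext p u v)"
  by (simp add: bilinear_ext_eq_left lin_ext_F_scale F.vector_space_axioms)

lemma bilinear_ext_scale_right: "bilinear_ext p u (F_scale c v) = F_scale c (bilinear_ext p u v)"
  by (simp add: bilinear_ext_eq_right lin_ext_F_scale F.vector_space_axioms)

lemmas bilinear_ext_linear =
  bilinear_ext_add_left bilinear_ext_add_right bilinear_ext_scale_left bilinear_ext_scale_right

lemma bilinear_ext_single:
  "bilinear_ext p (Poly_Mapping.single s c) (Poly_Mapping.single t d) =
    Poly_Mapping.single (p s t) (c * d)"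
  by (simp add: bilinear_ext_eq_left F.lin_ext_single F_scale_single)

section \<open>Edge valued trees\<close>

abbreviation one_node :: evtree where
  "one_node \<equiv> Node \<infinity> Leaf \<infinity> Leaf"

lemma one_node_in_evtrees: "one_node \<in> evtrees \<gamma>"
  by (simp add: evtrees_def)

lemma edge_ok_iff: "edge_ok \<gamma> x t \<longleftrightarrow> (if t = Leaf then x = \<infinity> else x \<in> enat ` {1..\<gamma>})"
  by (cases t) auto

lemma edge_okE:
  assumes "edge_ok \<gamma> x t"
  obtains (Leaf) "t = Leaf" "x = \<infinity>" | (internal) a where "t \<noteq> Leaf" "x = enat a" "a \<in> {1..\<gamma>}"
  using assms by (auto simp: edge_ok_iff split: if_splits)

lemma tree_L_Leaf_left [simp]: "tree_L a Leaf s = s"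
  by (cases s) auto

lemma tree_L_Node:
  "s \<noteq> Leaf \<Longrightarrow> tree_L a (Node x t\<^sub>1 y t\<^sub>2) s = Node x t\<^sub>1 (min (enat a) y) (tree_L a t\<^sub>2 s)"
  by (cases s) auto

lemma tree_L_eq_Leaf_iff [simp]: "tree_L a t s = Leaf \<longleftrightarrow> t = Leaf \<and> s = Leaf"
  by (cases "(a, t, s)" rule: tree_L.cases) auto

lemma edge_ok_tree_L:
  assumes "a \<in> {1..\<gamma>}" "edge_ok \<gamma> x t" "s \<noteq> Leaf"
  shows "edge_ok \<gamma> (min (enat a) x) (tree_L a t s)"
  using assms by (auto simp: edge_ok_iff min_def split: if_splits)

lemma labels_ok_tree_L:
  assumes "a \<in> {1..\<gamma>}" "labels_ok \<gamma> t" "labels_ok \<gamma> s"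
  shows "labels_ok \<gamma> (tree_L a t s)"
  using assms by (induction a t s rule: tree_L.induct) (auto intro!: edge_ok_tree_L)

lemma tree_L_in_evtrees:
  "\<lbrakk>a \<in> {1..\<gamma>}; s \<in> evtrees \<gamma>; t \<in> evtrees \<gamma>\<rbrakk> \<Longrightarrow> tree_L a s t \<in> evtrees \<gamma>"
  by (simp add: evtrees_def labels_ok_tree_L)

lemma tree_L_tree_L:
  assumes "t \<noteq> Leaf" "u \<noteq> Leaf"
  shows "tree_L a (tree_L a' s t) u = tree_L (min a a') s (tree_L a t u)"
  using assms
  by (induction s)
    (auto simp: tree_L_Node min.assoc min_enat_simps(1)[symmetric] simp del: min_enat_simps)

primrec mirror :: "evtree \<Rightarrow> evtree" where
  "mirror Leaf = Leaf"
| "mirror (Node x t\<^sub>1 y t\<^sub>2) = Node y (mirror t\<^sub>2) x (mirror t\<^sub>1)"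

lemma mirror_mirror [simp]: "mirror (mirror t) = t"
  by (induction t) auto

lemma mirror_eq_Leaf_iff [simp]: "mirror t = Leaf \<longleftrightarrow> t = Leaf"
  by (cases t) auto

lemma labels_ok_mirror [simp]: "labels_ok \<gamma> (mirror t) \<longleftrightarrow> labels_ok \<gamma> t"
  by (induction t) (auto simp: edge_ok_iff)

lemma mirror_in_evtrees_iff [simp]: "mirror t \<in> evtrees \<gamma> \<longleftrightarrow> t \<in> evtrees \<gamma>"
  by (simp add: evtrees_def)

lemma tree_R_eq_mirror: "tree_R a s t = mirror (tree_L a (mirror t) (mirror s))"
  by (induction a s t rule: tree_R.induct) (simp_all add: tree_L_Node)

lemma tree_R_in_evtrees:
  "\<lbrakk>a \<in> {1..\<gamma>}; s \<in> evtrees \<gamma>; t \<in> evtrees \<gamma>\<rbrakk> \<Longrightarrow> tree_R a s t \<in> evtrees \<gamma>"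
  by (simp add: tree_R_eq_mirror tree_L_in_evtrees)

lemma tree_R_tree_R:
  assumes "s \<noteq> Leaf" "t \<noteq> Leaf"
  shows "tree_R (min a a') (tree_R a s t) u = tree_R a s (tree_R a' t u)"
  using assms by (simp add: tree_R_eq_mirror tree_L_tree_L)

lemma tree_L_tree_R:
  assumes "t \<noteq> Leaf"
  shows "tree_L a (tree_R a' s t) u = tree_R a' s (tree_L a t u)"
  using assms by (cases s; cases t; cases u) auto

lemma evtrees_induct [consumes 1, case_names one_node tree_L tree_R]:
  assumes "t \<in> evtrees \<gamma>"
    and one_node: "P one_node"
    and tree_L: "\<And>a s t. \<lbrakk>a \<in> {1..\<gamma>}; s \<in> evtrees \<gamma>; t \<in> evtrees \<gamma>; P s; P t\<rbrakk> \<Longrightarrow> P (tree_L a s t)"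
    and tree_R: "\<And>a s t. \<lbrakk>a \<in> {1..\<gamma>}; s \<in> evtrees \<gamma>; t \<in> evtrees \<gamma>; P s; P t\<rbrakk> \<Longrightarrow> P (tree_R a s t)"
  shows "P t"
  using assms(1)
proof (induction t)
  case Leaf
  then show ?case by (simp add: evtrees_def)
next
  case (Node x t\<^sub>1 y t\<^sub>2)
  let ?r = "Node \<infinity> Leaf y t\<^sub>2"
  have labels: "edge_ok \<gamma> x t\<^sub>1" "edge_ok \<gamma> y t\<^sub>2" "labels_ok \<gamma> t\<^sub>1" "labels_ok \<gamma> t\<^sub>2"
    using Node.prems by (auto simp: evtrees_def)
  have r_in: "?r \<in> evtrees \<gamma>"
    using labels by (simp add: evtrees_def)
  from \<open>edge_ok \<gamma> y t\<^sub>2\<close> have P_r: "P ?r"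
  proof (cases rule: edge_okE)
    case Leaf
    then show ?thesis using one_node by simp
  next
    case (internal a)
    then have "t\<^sub>2 \<in> evtrees \<gamma>"
      using labels by (simp add: evtrees_def)
    then have "P (tree_L a one_node t\<^sub>2)"
      using internal Node.IH(2) one_node by (intro tree_L one_node_in_evtrees)
    with internal show ?thesis by (simp add: tree_L_Node)
  qed
  from \<open>edge_ok \<gamma> x t\<^sub>1\<close> show ?case
  proof (cases rule: edge_okE)
    case Leaf
    with P_r show ?thesis by simp
  next
    case (internal a)
    then have "t\<^sub>1 \<in> evtrees \<gamma>"
      using labels by (simp add: evtrees_def)
    then have "P (tree_R a t\<^sub>1 ?r)"
      using internal Node.IH(1) r_in P_r by (intro tree_R)
    with internal show ?thesis by (cases t\<^sub>1) simp_all
  qed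
qed

section \<open>The algebra of trees\<close>

lemma subspace_F_space: "F.subspace (F_space \<gamma>)"
  by (auto simp: F.subspace_def F_space_def
      dest!: subsetD[OF Poly_Mapping.keys_add] subsetD[OF keys_F_scale_subset])

lemma single_in_F_space: "t \<in> evtrees \<gamma> \<Longrightarrow> Poly_Mapping.single t c \<in> F_space \<gamma>"
  by (simp add: F_space_def)

lemma F_gen_in_F_space: "F_gen \<in> F_space \<gamma>"
  by (simp add: F_gen_def single_in_F_space one_node_in_evtrees)

lemma F_space_eq_span: "F_space \<gamma> = F.span ((\<lambda>t. Poly_Mapping.single t 1) ` evtrees \<gamma>)"
    (is "_ = F.span ?B")
proof
  show "F_space \<gamma> \<subseteq> F.span ?B"
  proof
    fix v :: "evtree \<Rightarrow>\<^sub>0 'a"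
    assume "v \<in> F_space \<gamma>"
    then have "lin_ext F_scale (\<lambda>t. Poly_Mapping.single t 1) v \<in> F.span ?B"
      by (intro F.lin_ext_in_subspace F.subspace_span) (auto simp: F_space_def intro: F.span_base)
    then show "v \<in> F.span ?B"
      by (simp only: lin_ext_F_scale_single_1)
  qed
  show "F.span ?B \<subseteq> F_space \<gamma>"
    by (intro F.span_minimal subspace_F_space) (auto intro: single_in_F_space)
qed

lemma linear_map_on_F_space_eqI:
  assumes "linear_map_on F_scale scale (F_space \<gamma>) f" "linear_map_on F_scale scale (F_space \<gamma>) g"
    and eq: "\<And>t. t \<in> evtrees \<gamma> \<Longrightarrow> f (Poly_Mapping.single t 1) = g (Poly_Mapping.single t 1)"
    and "v \<in> F_space \<gamma>"
  shows "f v = g v"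
proof -
  note span = assms(1,2,4)[unfolded F_space_eq_span]
  show ?thesis
    by (rule linear_map_on_eq_on_span[OF F.vector_space_axioms span(1,2) _ span(3)])
      (use eq in blast)
qed

lemma bilinear_ext_in_F_space:
  assumes p: "\<And>s t. \<lbrakk>s \<in> evtrees \<gamma>; t \<in> evtrees \<gamma>\<rbrakk> \<Longrightarrow> p s t \<in> evtrees \<gamma>"
    and "u \<in> F_space \<gamma>" "v \<in> F_space \<gamma>"
  shows "bilinear_ext p u v \<in> F_space \<gamma>"
  unfolding bilinear_ext_eq_left using assms(2,3)
  by (intro F.lin_ext_in_subspace[OF subspace_F_space] image_subsetI single_in_F_space p)
    (auto simp: F_space_def)

lemma bilinear_ext_assoc:
  assumes u: "u \<in> F_space \<gamma>" and v: "v \<in> F_space \<gamma>" and w: "w \<in> F_space \<gamma>"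
    and assoc: "\<And>r s t. \<lbrakk>r \<in> evtrees \<gamma>; s \<in> evtrees \<gamma>; t \<in> evtrees \<gamma>\<rbrakk>
      \<Longrightarrow> p (q r s) t = p' r (q' s t)"
  shows "bilinear_ext p (bilinear_ext q u v) w = bilinear_ext p' u (bilinear_ext q' v w)"
proof -
  let ?l = "\<lambda>u v w. bilinear_ext p (bilinear_ext q u v) w"
  let ?r = "\<lambda>u v w. bilinear_ext p' u (bilinear_ext q' v w)"
  let ?\<delta> = "\<lambda>t. Poly_Mapping.single t 1"
  note eqI = linear_map_on_F_space_eqI[where scale = F_scale]
  have trees_w: "?l (?\<delta> r) (?\<delta> s) w = ?r (?\<delta> r) (?\<delta> s) w"
    if "r \<in> evtrees \<gamma>" "s \<in> evtrees \<gamma>" for r s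
    by (rule eqI[OF _ _ _ w, where f = "?l (?\<delta> r) (?\<delta> s)" and g = "?r (?\<delta> r) (?\<delta> s)"])
      (use that assoc in \<open>simp_all add: linear_map_on_def bilinear_ext_linear bilinear_ext_single\<close>)
  have tree_v_w: "?l (?\<delta> r) v w = ?r (?\<delta> r) v w" if "r \<in> evtrees \<gamma>" for r
    by (rule eqI[OF _ _ _ v, where f = "\<lambda>v. ?l (?\<delta> r) v w" and g = "\<lambda>v. ?r (?\<delta> r) v w"])
      (use that trees_w in \<open>simp_all add: linear_map_on_def bilinear_ext_linear\<close>)
  show ?thesis
    by (rule eqI[OF _ _ _ u, where f = "\<lambda>u. ?l u v w" and g = "\<lambda>u. ?r u v w"])
      (use tree_v_w in \<open>simp_all add: linear_map_on_def bilinear_ext_linear\<close>)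
qed

lemma multiplicial_algebra_F: "multiplicial_algebra F_scale \<gamma> (F_space \<gamma>) F_L F_R"
proof unfold_locales
  show "F.subspace (F_space \<gamma>)"
    by (rule subspace_F_space)
next
  fix a a' and x y z :: "evtree \<Rightarrow>\<^sub>0 'a"
  assume V: "x \<in> F_space \<gamma>" "y \<in> F_space \<gamma>" "z \<in> F_space \<gamma>"
  show "F_L a (F_R a' x y) z = F_R a' x (F_L a y z)"
    unfolding F_L_def F_R_def
    by (rule bilinear_ext_assoc[OF V]) (simp add: evtrees_def tree_L_tree_R)
  show "F_L a (F_L a' x y) z = F_L (min a a') x (F_L a y z)"
    unfolding F_L_def
    by (rule bilinear_ext_assoc[OF V]) (simp add: evtrees_def tree_L_tree_L)
  show "F_R (min a a') (F_R a x y) z = F_R a x (F_R a' y z)"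
    unfolding F_R_def
    by (rule bilinear_ext_assoc[OF V]) (simp add: evtrees_def tree_R_tree_R)
qed (auto simp: F_L_def F_R_def bilinear_ext_linear
    intro!: bilinear_ext_in_F_space tree_L_in_evtrees tree_R_in_evtrees)

section \<open>Evaluation of trees\<close>

(* The value at Leaf is junk. *)
primrec tree_eval :: "(nat \<Rightarrow> 'b \<Rightarrow> 'b \<Rightarrow> 'b) \<Rightarrow> (nat \<Rightarrow> 'b \<Rightarrow> 'b \<Rightarrow> 'b) \<Rightarrow> 'b \<Rightarrow> evtree \<Rightarrow> 'b" where
  "tree_eval L R e Leaf = e"
| "tree_eval L R e (Node x t\<^sub>1 y t\<^sub>2) =
    (let r = (if t\<^sub>2 = Leaf then e else L (the_enat y) e (tree_eval L R e t\<^sub>2))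
     in if t\<^sub>1 = Leaf then r else R (the_enat x) (tree_eval L R e t\<^sub>1) r)"

context multiplicial_algebra
begin

lemma multiplicial_algebra_opposite:
  "multiplicial_algebra scale \<gamma> V (\<lambda>a x y. R a y x) (\<lambda>a x y. L a y x)"
  by unfold_locales
    (simp_all add: subspace_carrier L_closed R_closed L_add_left L_add_right L_scale_left
      L_scale_right R_add_left R_add_right R_scale_left R_scale_right R_L L_L R_R)

lemma tree_eval_in_carrier:
  assumes "e \<in> V" "labels_ok \<gamma> t"
  shows "tree_eval L R e t \<in> V"
  using assms
  by (induction t) (auto simp: Let_def edge_ok_iff split: if_splits intro!: L_closed R_closed)

lemma tree_eval_mirror:
  assumes "e \<in> V" "labels_ok \<gamma> t"
  shows "tree_eval (\<lambda>a x y. R a y x) (\<lambda>a x y. L a y x) e (mirror t) = tree_eval L R e t"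
  using assms by (induction t) (auto simp: Let_def edge_ok_iff tree_eval_in_carrier R_L)

lemma tree_eval_tree_L:
  assumes e: "e \<in> V" and a: "a \<in> {1..\<gamma>}" and "t \<in> evtrees \<gamma>" and s: "s \<in> evtrees \<gamma>"
  shows "tree_eval L R e (tree_L a t s) = L a (tree_eval L R e t) (tree_eval L R e s)"
  using \<open>t \<in> evtrees \<gamma>\<close>
proof (induction t)
  case Leaf
  then show ?case by (simp add: evtrees_def)
next
  case (Node x t\<^sub>1 y t\<^sub>2)
  let ?E = "tree_eval L R e"
  let ?r = "if t\<^sub>2 = Leaf then e else L (the_enat y) e (?E t\<^sub>2)"
  have labels: "edge_ok \<gamma> x t\<^sub>1" "edge_ok \<gamma> y t\<^sub>2" "labels_ok \<gamma> t\<^sub>1" "labels_ok \<gamma> t\<^sub>2"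
    using Node.prems by (auto simp: evtrees_def)
  then have in_V: "?E t\<^sub>1 \<in> V" "?E t\<^sub>2 \<in> V" "?E s \<in> V"
    using e s by (auto simp: evtrees_def tree_eval_in_carrier)
  have s_internal: "s \<noteq> Leaf"
    using s by (simp add: evtrees_def)
  from \<open>edge_ok \<gamma> y t\<^sub>2\<close> have right: "?r \<in> V \<and>
      L (the_enat (min (enat a) y)) e (?E (tree_L a t\<^sub>2 s)) = L a ?r (?E s)"
  proof (cases rule: edge_okE)
    case Leaf
    then show ?thesis using e by simp
  next
    case (internal b)
    then have "?E (tree_L a t\<^sub>2 s) = L a (?E t\<^sub>2) (?E s)"
      using Node.IH(2) labels by (simp add: evtrees_def)
    then show ?thesis
      using internal e a in_V by (simp add: L_closed L_L)
  qed
  from \<open>edge_ok \<gamma> x t\<^sub>1\<close> show ?case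
    using right a in_V s_internal
    by (cases rule: edge_okE) (auto simp: Let_def tree_L_Node R_L)
qed

lemma tree_eval_tree_R:
  assumes "e \<in> V" "a \<in> {1..\<gamma>}" "s \<in> evtrees \<gamma>" "t \<in> evtrees \<gamma>"
  shows "tree_eval L R e (tree_R a s t) = R a (tree_eval L R e s) (tree_eval L R e t)"
proof -
  interpret opp: multiplicial_algebra scale \<gamma> V "\<lambda>a x y. R a y x" "\<lambda>a x y. L a y x"
    by (rule multiplicial_algebra_opposite)
  let ?E' = "tree_eval (\<lambda>a x y. R a y x) (\<lambda>a x y. L a y x) e"
  have mirror: "?E' (mirror u) = tree_eval L R e u" if "u \<in> evtrees \<gamma>" for u
    using that assms(1) by (simp add: evtrees_def tree_eval_mirror)
  have "tree_eval L R e (tree_R a s t) = ?E' (mirror (tree_R a s t))"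
    using assms by (simp add: mirror tree_R_in_evtrees)
  also have "\<dots> = ?E' (tree_L a (mirror t) (mirror s))"
    by (simp add: tree_R_eq_mirror)
  also have "\<dots> = R a (?E' (mirror s)) (?E' (mirror t))"
    using assms by (simp add: opp.tree_eval_tree_L)
  finally show ?thesis
    using assms by (simp add: mirror)
qed

section \<open>Morphisms from the algebra of trees\<close>

lemma lin_ext_in_carrier:
  assumes "\<phi> \<in> evtrees \<gamma> \<rightarrow> V" "v \<in> F_space \<gamma>"
  shows "lin_ext scale \<phi> v \<in> V"
  using assms by (intro lin_ext_in_subspace[OF subspace_carrier]) (auto simp: F_space_def)

lemma commutes_on_lin_ext:
  assumes carrier: "\<phi> \<in> evtrees \<gamma> \<rightarrow> V"
    and hom: "\<And>a s t. \<lbrakk>a \<in> {1..\<gamma>}; s \<in> evtrees \<gamma>; t \<in> evtrees \<gamma>\<rbrakk> \<Longrightarrow> \<phi> (p a s t) = P a (\<phi> s) (\<phi> t)"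
    and linear_left: "\<And>a y. \<lbrakk>a \<in> {1..\<gamma>}; y \<in> V\<rbrakk> \<Longrightarrow> linear_map_on scale scale V (\<lambda>x. P a x y)"
    and linear_right: "\<And>a x. \<lbrakk>a \<in> {1..\<gamma>}; x \<in> V\<rbrakk> \<Longrightarrow> linear_map_on scale scale V (P a x)"
  shows "commutes_on \<gamma> (\<lambda>a. bilinear_ext (p a)) P (F_space \<gamma>) (lin_ext scale \<phi>)"
  unfolding commutes_on_def
proof (intro ballI)
  fix a and u v :: "evtree \<Rightarrow>\<^sub>0 'k"
  assume a: "a \<in> {1..\<gamma>}" and u: "u \<in> F_space \<gamma>" and v: "v \<in> F_space \<gamma>"
  let ?f = "lin_ext scale \<phi>"
  note f_linear = lin_ext_add lin_ext_F_scale[OF vector_space_axioms] bilinear_ext_linear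
  have tree_v: "?f (bilinear_ext (p a) (Poly_Mapping.single s 1) v) = P a (\<phi> s) (?f v)"
    if s: "s \<in> evtrees \<gamma>" for s
  proof (rule linear_map_on_F_space_eqI[OF _ _ _ v, where scale = scale
          and f = "\<lambda>v. ?f (bilinear_ext (p a) (Poly_Mapping.single s 1) v)"
          and g = "\<lambda>v. P a (\<phi> s) (?f v)"])
    have "linear_map_on scale scale V (P a (\<phi> s))"
      using a s carrier by (intro linear_right) auto
    then show "linear_map_on F_scale scale (F_space \<gamma>) (\<lambda>v. P a (\<phi> s) (?f v))"
      by (simp add: linear_map_on_def f_linear lin_ext_in_carrier[OF carrier])
  qed (use a s hom in \<open>simp_all add: linear_map_on_def f_linear bilinear_ext_single lin_ext_single\<close>)
  show "?f (bilinear_ext (p a) u v) = P a (?f u) (?f v)"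
  proof (rule linear_map_on_F_space_eqI[OF _ _ _ u, where scale = scale
          and f = "\<lambda>u. ?f (bilinear_ext (p a) u v)" and g = "\<lambda>u. P a (?f u) (?f v)"])
    show "linear_map_on F_scale scale (F_space \<gamma>) (\<lambda>u. P a (?f u) (?f v))"
      using linear_left[OF a lin_ext_in_carrier[OF carrier v]]
      by (simp add: linear_map_on_def f_linear lin_ext_in_carrier[OF carrier])
  qed (simp_all add: linear_map_on_def f_linear tree_v lin_ext_single)
qed

definition evtree_homs :: "((evtree \<Rightarrow>\<^sub>0 'k) \<Rightarrow> 'b) set" where
  "evtree_homs = {f \<in> F_space \<gamma> \<rightarrow>\<^sub>E V. linear_map_on F_scale scale (F_space \<gamma>) f
    \<and> commutes_on \<gamma> F_L L (F_space \<gamma>) f \<and> commutes_on \<gamma> F_R R (F_space \<gamma>) f}"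

lemma restrict_in_evtree_homs:
  assumes "f \<in> F_space \<gamma> \<rightarrow> V" "linear_map_on F_scale scale (F_space \<gamma>) f"
    "commutes_on \<gamma> F_L L (F_space \<gamma>) f" "commutes_on \<gamma> F_R R (F_space \<gamma>) f"
  shows "restrict f (F_space \<gamma>) \<in> evtree_homs"
proof -
  interpret trees: multiplicial_algebra "F_scale :: 'k \<Rightarrow> _" \<gamma> "F_space \<gamma>" F_L F_R
    by (rule multiplicial_algebra_F)
  show ?thesis
    using assms
    by (auto simp: evtree_homs_def linear_map_on_def commutes_on_def trees.L_closed trees.R_closed
        F.subspace_add[OF subspace_F_space] F.subspace_scale[OF subspace_F_space])
qed

lemma evtree_hom_exists:
  assumes e: "e \<in> V"
  shows "\<exists>f\<in>evtree_homs. f F_gen = e"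
proof
  let ?E = "tree_eval L R e"
  let ?f = "lin_ext scale ?E"
  have carrier: "?E \<in> evtrees \<gamma> \<rightarrow> V"
    using e by (auto simp: evtrees_def tree_eval_in_carrier)
  show "restrict ?f (F_space \<gamma>) \<in> evtree_homs"
  proof (rule restrict_in_evtree_homs)
    show "?f \<in> F_space \<gamma> \<rightarrow> V"
      using carrier by (simp add: lin_ext_in_carrier)
    show "linear_map_on F_scale scale (F_space \<gamma>) ?f"
      by (rule linear_map_on_lin_ext[OF vector_space_axioms])
    show "commutes_on \<gamma> F_L L (F_space \<gamma>) ?f"
      unfolding F_L_def
      by (rule commutes_on_lin_ext[OF carrier])
        (simp_all add: e tree_eval_tree_L linear_map_on_def
          L_add_left L_add_right L_scale_left L_scale_right)
    show "commutes_on \<gamma> F_R R (F_space \<gamma>) ?f"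
      unfolding F_R_def
      by (rule commutes_on_lin_ext[OF carrier])
        (simp_all add: e tree_eval_tree_R linear_map_on_def
          R_add_left R_add_right R_scale_left R_scale_right)
  qed
  show "restrict ?f (F_space \<gamma>) F_gen = e"
    by (simp add: F_gen_in_F_space) (simp add: F_gen_def lin_ext_single)
qed

lemma evtree_hom_single:
  assumes "f \<in> evtree_homs" "a \<in> {1..\<gamma>}" "s \<in> evtrees \<gamma>" "t \<in> evtrees \<gamma>"
  shows "f (Poly_Mapping.single (tree_L a s t) 1) =
      L a (f (Poly_Mapping.single s 1)) (f (Poly_Mapping.single t 1))"
    and "f (Poly_Mapping.single (tree_R a s t) 1) =
      R a (f (Poly_Mapping.single s 1)) (f (Poly_Mapping.single t 1))"
proof -
  let ?s = "Poly_Mapping.single s (1::'k)" and ?t = "Poly_Mapping.single t (1::'k)"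
  have "f (F_L a ?s ?t) = L a (f ?s) (f ?t)" "f (F_R a ?s ?t) = R a (f ?s) (f ?t)"
    using assms single_in_F_space unfolding evtree_homs_def commutes_on_def by blast+
  then show "f (Poly_Mapping.single (tree_L a s t) 1) = L a (f ?s) (f ?t)"
    and "f (Poly_Mapping.single (tree_R a s t) 1) = R a (f ?s) (f ?t)"
    by (simp_all add: F_L_def F_R_def bilinear_ext_single)
qed

lemma evtree_hom_eqI:
  assumes f: "f \<in> evtree_homs" and g: "g \<in> evtree_homs" and gen: "f F_gen = g F_gen"
  shows "f = g"
proof (rule PiE_ext)
  show "f \<in> F_space \<gamma> \<rightarrow>\<^sub>E V" "g \<in> F_space \<gamma> \<rightarrow>\<^sub>E V"
    using f g by (simp_all add: evtree_homs_def)
  fix v :: "evtree \<Rightarrow>\<^sub>0 'k"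
  assume "v \<in> F_space \<gamma>"
  then show "f v = g v"
  proof (rule linear_map_on_F_space_eqI[where scale = scale, rotated 3])
    show "linear_map_on F_scale scale (F_space \<gamma>) f" "linear_map_on F_scale scale (F_space \<gamma>) g"
      using f g by (simp_all add: evtree_homs_def)
    show "f (Poly_Mapping.single t 1) = g (Poly_Mapping.single t 1)" if "t \<in> evtrees \<gamma>" for t
      using that
    proof (induction rule: evtrees_induct)
      case one_node
      then show ?case using gen by (simp add: F_gen_def)
    qed (simp_all add: evtree_hom_single[OF f] evtree_hom_single[OF g])
  qed
qed

lemma ex1_evtree_hom:
  assumes "e \<in> V"
  shows "\<exists>!f. f \<in> evtree_homs \<and> f F_gen = e"
  using evtree_hom_exists[OF assms] evtree_hom_eqI by blast

end

theorem theorem4p1p6: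
  fixes \<gamma> :: nat
  shows "multiplicial_algebra (F_scale :: 'k::field_char_0 \<Rightarrow> _) \<gamma> (F_space \<gamma>) F_L F_R
    \<and> (F_gen :: evtree \<Rightarrow>\<^sub>0 'k) \<in> F_space \<gamma>
    \<and> (\<forall>(scale :: 'k \<Rightarrow> 'b::ab_group_add \<Rightarrow> 'b) A L R. \<forall>e\<in>A.
         multiplicial_algebra scale \<gamma> A L R \<longrightarrow>
         (\<exists>!f. f \<in> F_space \<gamma> \<rightarrow>\<^sub>E A
            \<and> linear_map_on F_scale scale (F_space \<gamma>) f
            \<and> commutes_on \<gamma> F_L L (F_space \<gamma>) f
            \<and> commutes_on \<gamma> F_R R (F_space \<gamma>) f
            \<and> f F_gen = e))"
proof (intro conjI allI ballI impI)
  show "multiplicial_algebra (F_scale :: 'k \<Rightarrow> _) \<gamma> (F_space \<gamma>) F_L F_R"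
    by (rule multiplicial_algebra_F)
  show "(F_gen :: evtree \<Rightarrow>\<^sub>0 'k) \<in> F_space \<gamma>"
    by (rule F_gen_in_F_space)
next
  fix scale :: "'k \<Rightarrow> 'b \<Rightarrow> 'b" and A L R e
  assume "e \<in> A" and "multiplicial_algebra scale \<gamma> A L R"
  then interpret multiplicial_algebra scale \<gamma> A L R by simp
  show "\<exists>!f. f \<in> F_space \<gamma> \<rightarrow>\<^sub>E A
            \<and> linear_map_on F_scale scale (F_space \<gamma>) f
            \<and> commutes_on \<gamma> F_L L (F_space \<gamma>) f
            \<and> commutes_on \<gamma> F_R R (F_space \<gamma>) f
            \<and> f F_gen = e"
    using ex1_evtree_hom[OF \<open>e \<in> A\<close>] by (simp add: evtree_homs_def)
qed

end
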